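(* Let $q$ be a prime power. For $b\in\mathbb{F}_{q^4}$ let $U(b)=\{(x,bx^q+x^{q^3}) : x\in\mathbb{F}_{q^4}\}\subseteq\mathbb{F}_{q^4}^2$ and let $L_{U(b)}$ be the associated $\mathbb{F}_q$-linear set of $\mathrm{PG}(1,q^4)$. For $b\in\mathbb{F}_{q^4}$ the following holds. 1. If $\mathrm{N}_{q^4/q}(b)\neq 1$, then $L_{U(b)}$ is scattered. 2. If $\mathrm{N}_{q^4/q^2}(b)=1$, then $L_{U(b)}$ has a unique point with weight two, the point $\langle(1,0)\rangle_{\mathbb{F}_{q^4}}$, and all other points of $L_{U(b)}$ have weight one. 3. If $\mathrm{N}_{q^4/q^2}(b)\neq 1$ and $\mathrm{N}_{q^4/q}(b)=1$, then $L_{U(b)}$ has exactly $q+1$ points with weight two and all other points of $L_{U(b)}$ have weight one.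
   Context: Points of $\mathrm{PG}(1,q^4)$ are the one-dimensional $\mathbb{F}_{q^4}$-subspaces $\langle \mathbf v\rangle_{\mathbb{F}_{q^4}}$, $\mathbf v\neq \mathbf 0$, of $\mathbb{F}_{q^4}^2$. For an $\mathbb{F}_q$-subspace $U$ of $\mathbb{F}_{q^4}^2$, the associated $\mathbb{F}_q$-linear set is $L_U=\{\langle \mathbf v\rangle_{\mathbb{F}_{q^4}} : \mathbf v\in U\setminus\{\mathbf 0\}\}$; its rank is $\dim_{\mathbb{F}_q}U$. The weight of a point $P=\langle\mathbf v\rangle_{\mathbb{F}_{q^4}}$ is $w(P)=\dim_{\mathbb{F}_q}(U\cap P)$. $L_U$ is scattered if all its points have weight one (equivalently, if $|L_U|=(q^r-1)/(q-1)$ with $r$ the rank). The norms are $\mathrm{N}_{q^4/q}(b)=b^{1+q+q^2+q^3}$ and $\mathrm{N}_{q^4/q^2}(b)=b^{q^2+1}$. *)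

theory Defs
  imports "HOL-Library.Cardinality" "HOL-Library.Product_Plus" "HOL-Number_Theory.Prime_Powers"
begin

text \<open>
  An extension of fields is represented by an embedding \<open>\<iota> :: 'k \<Rightarrow> 'a\<close>: the smaller field
  (of order \<open>q\<close>) is the type \<open>'k\<close>, the larger one (of order \<open>q\<^sup>4\<close>) is the type \<open>'a\<close>, and
  \<open>'k\<close> acts on \<open>'a \<times> 'a\<close> through \<open>\<iota>\<close>. Injectivity of \<open>\<iota>\<close> is automatic for fields.
\<close>

locale field_embedding =
  fixes \<iota> :: "'k::field \<Rightarrow> 'a::field"
  assumes hom_one: "\<iota> 1 = 1"
    and hom_add: "\<iota> (x + y) = \<iota> x + \<iota> y"
    and hom_mult: "\<iota> (x * y) = \<iota> x * \<iota> y"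

definition scale_pair :: "'a::field \<Rightarrow> 'a \<times> 'a \<Rightarrow> 'a \<times> 'a" where
  "scale_pair c v = (c * fst v, c * snd v)"

lemma vector_space_scale_pair: "vector_space scale_pair"
  by unfold_locales (auto simp: scale_pair_def algebra_simps)

lemma (in field_embedding) vector_space_restrict_scalars:
  "vector_space (\<lambda>c. scale_pair (\<iota> c))"
  by unfold_locales
    (auto simp: scale_pair_def hom_one hom_add hom_mult algebra_simps)

text \<open>
  A point of the projective line is a one-dimensional subspace over the large field, as a set of
  vectors (containing the zero vector).
\<close>

definition proj_point :: "'a::field \<times> 'a \<Rightarrow> ('a \<times> 'a) set" where
  "proj_point v = module.span scale_pair {v}"

definition linear_set :: "('a::field \<times> 'a) set \<Rightarrow> ('a \<times> 'a) set set" where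
  "linear_set U = {proj_point v | v. v \<in> U - {0}}"

text \<open>
  Weights are relative to the subspace \<open>U\<close> defining the linear set, not only to the set of points.
\<close>

definition weight ::
  "('k::field \<Rightarrow> 'a::field) \<Rightarrow> ('a \<times> 'a) set \<Rightarrow> ('a \<times> 'a) set \<Rightarrow> nat" where
  "weight \<iota> U P = vector_space.dim (\<lambda>c. scale_pair (\<iota> c)) (U \<inter> P)"

definition scattered :: "('k::field \<Rightarrow> 'a::field) \<Rightarrow> ('a \<times> 'a) set \<Rightarrow> bool" where
  "scattered \<iota> U \<longleftrightarrow> (\<forall>P \<in> linear_set U. weight \<iota> U P = 1)"

text \<open>The norms from the field of order \<open>q\<^sup>4\<close> to its subfields of orders \<open>q\<close> and \<open>q\<^sup>2\<close>.\<close>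

definition norm_q4_q :: "nat \<Rightarrow> 'a::field \<Rightarrow> 'a" where
  "norm_q4_q q b = b ^ (1 + q + q^2 + q^3)"

definition norm_q4_q2 :: "nat \<Rightarrow> 'a::field \<Rightarrow> 'a" where
  "norm_q4_q2 q b = b ^ (q^2 + 1)"

definition Ub :: "nat \<Rightarrow> 'a::field \<Rightarrow> ('a \<times> 'a) set" where
  "Ub q b = {(x, b * x ^ q + x ^ (q^3)) | x. x \<in> UNIV}"

end

theory Submission
  imports Defs "HOL-Computational_Algebra.Polynomial" "HOL-Number_Theory.Residues"
begin

text \<open>
  Write \<open>f x = b x\<^sup>q + x^(q^3)\<close> and \<open>b\<^sub>i\<close>, \<open>m\<^sub>i\<close>, \<open>x\<^sub>i\<close> for the \<open>i\<close>-th Frobenius conjugates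
  (indices modulo 4). Every point of \<open>L\<^bsub>U(b)\<^esub>\<close> is \<open>\<langle>(1, m)\<rangle>\<close> with \<open>m = f x / x\<close>, and its
  weight is the dimension of the kernel of \<open>x \<mapsto> f x - m x\<close>, called the slope kernel of \<open>m\<close> below;
  its cardinality \<open>q^w\<close> therefore determines the weight \<open>w\<close>
  (\<open>card_slope_kernel_eq_power_weight\<close>).

  The four conjugates of \<open>x\<^sub>3 + b x\<^sub>1 = m x\<close> are linear relations between \<open>x, x\<^sub>1, x\<^sub>2, x\<^sub>3\<close>. Eliminating
  \<open>x\<close> and \<open>x\<^sub>3\<close> from three of them leaves
  \<open>(1 + b\<^sub>2 m m\<^sub>1 - b b\<^sub>2) x\<^sub>1 = (m\<^sub>2 + m b\<^sub>1 b\<^sub>2) x\<^sub>2\<close>.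
  If one of the two coefficients is nonzero, then \<open>x\<^sub>1\<close> is a root of a nonzero polynomial of degree at
  most \<open>q\<close>, and the weight is at most one (\<open>card_slope_kernel_le_if_not_heavy\<close>). If both vanish, the
  slope \<open>m\<close> is called heavy, and the weight is exactly two (\<open>card_slope_kernel_if_heavy\<close>): the kernel
  lies in the roots of a polynomial of degree \<open>q\<^sup>2\<close>, and it contains the image of an additive map
  which is itself given by a polynomial of degree \<open>q\<^sup>2\<close>, hence has an image of at least
  \<open>q^4 / q\<^sup>2\<close> elements.

  Points of weight two thus correspond to heavy slopes, and it remains to count these. The relation
  \<open>m\<^sub>2 = - m b\<^sub>1 b\<^sub>2\<close>, applied twice, gives \<open>m = m N(b)\<close> with \<open>N(b) = b b\<^sub>1 b\<^sub>2 b\<^sub>3\<close>, so a nonzero heavy \<open>m\<close> forces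
  \<open>N(b) = 1\<close>; and \<open>m = 0\<close> is heavy only if \<open>b b\<^sub>2 = 1\<close>, which gives \<open>N(b) = 1\<close> as well. If
  \<open>b b\<^sub>2 = 1\<close>, the other relation reads \<open>b\<^sub>2 m m\<^sub>1 = 0\<close> and \<open>m = 0\<close> is the only heavy slope. If \<open>N(b) = 1\<close>
  and \<open>b b\<^sub>2 \<noteq> 1\<close>, the other relation reads \<open>m^(q+1) = c\<close> for a nonzero \<open>c\<close> with \<open>c^(q-1) = - b\<^sub>1 b\<^sub>2\<close>;
  it implies \<open>m\<^sub>2 = - m b\<^sub>1 b\<^sub>2\<close>, and it has \<open>q + 1\<close> solutions because
  \<open>c^((q-1)(q\<^sup>2+1)) = (- b\<^sub>1 b\<^sub>2) (- b\<^sub>3 b) = 1\<close> (\<open>card_heavy\<close>).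
\<close>

section \<open>Counting\<close>

lemma card_le_image_mult_fibre_bound:
  assumes "finite A" and "\<And>y. y \<in> f ` A \<Longrightarrow> card {x \<in> A. f x = y} \<le> N"
  shows "card A \<le> card (f ` A) * N"
proof -
  have "card A = (\<Sum>y\<in>f ` A. card {x \<in> A. f x = y})"
    using sum.image_gen[OF assms(1), of "\<lambda>_. 1::nat" f] by simp
  also have "\<dots> \<le> card (f ` A) * N"
    using sum_bounded_above[of "f ` A" "\<lambda>y. card {x \<in> A. f x = y}" N] assms(2) by simp
  finally show ?thesis .
qed

text \<open>
  Coordinates with respect to a basis identify the subspace with the functions from the basis to the
  scalars.
\<close>

lemma (in vector_space) card_subspace_eq_power_dim:
  assumes S: "subspace S" and fin: "finite S"
  shows "card S = CARD('a) ^ dim S"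
proof -
  obtain B where B: "B \<subseteq> S" "independent B" "S \<subseteq> span B" "card B = dim S"
    by (rule basis_exists)
  have finB: "finite B"
    using B(1) fin by (rule finite_subset)
  have span: "span B = S"
    using B(1,3) S by (simp add: span_minimal subset_antisym)
  let ?f = "\<lambda>u. \<Sum>v\<in>B. u v *s v"
  let ?E = "B \<rightarrow>\<^sub>E (UNIV :: 'a set)"
  have "inj_on ?f ?E"
  proof (rule inj_onI)
    fix u w assume u: "u \<in> ?E" and w: "w \<in> ?E" and eq: "?f u = ?f w"
    have "(\<Sum>v\<in>B. (u v - w v) *s v) = 0"
      using eq by (simp add: scale_left_diff_distrib sum_subtractf)
    then have "u v - w v = 0" if "v \<in> B" for v
      using independentD[OF B(2) finB subset_refl, where u = "\<lambda>v. u v - w v"] that by blast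
    then show "u = w"
      by (intro PiE_ext[OF u w]) auto
  qed
  moreover have "?f ` ?E = S"
  proof -
    have "?f u \<in> ?f ` ?E" for u
      by (rule image_eqI[of _ _ "restrict u B"]) auto
    then have "range ?f = ?f ` ?E"
      by blast
    then show ?thesis
      using span span_finite[OF finB] by simp
  qed
  ultimately have "card S = card ?E"
    using card_image[of ?f ?E] by simp
  then show ?thesis
    using B(4) by (simp add: card_funcsetE[OF finB])
qed

text \<open>
  Multiplication by \<open>x\<close> permutes the nonzero elements, so it leaves their product unchanged.
\<close>

lemma finite_field_power_card_minus_1:
  fixes x :: "'a::{field,finite}"
  assumes "x \<noteq> 0"
  shows "x ^ (CARD('a) - 1) = 1"
proof -
  have "(\<Prod>y\<in>UNIV-{0}. x * y) = (\<Prod>y\<in>UNIV-{0}. y)"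
    by (rule prod.reindex_bij_witness[of _ "\<lambda>y. y / x" "\<lambda>y. x * y"]) (use assms in auto)
  then show ?thesis
    by (simp add: prod.distrib card_Diff_singleton)
qed

lemma finite_field_power_card:
  fixes x :: "'a::{field,finite}"
  shows "x ^ CARD('a) = x"
proof (cases "x = 0")
  case False
  have "x ^ CARD('a) = x ^ (CARD('a) - 1) * x"
    by (simp flip: power_Suc2)
  with False show ?thesis
    using finite_field_power_card_minus_1[of x] by simp
qed simp

lemma card_nth_roots_le:
  fixes c :: "'a::field"
  assumes "n > 0"
  shows "card {z. z ^ n = c} \<le> n"
proof -
  let ?p = "Polynomial.monom 1 n - [:c:]"
  have deg: "degree ?p = n"
    using assms by (subst diff_conv_add_uminus, subst degree_add_eq_left) (auto simp: degree_monom_eq)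
  then have "?p \<noteq> 0"
    using assms by fastforce
  from card_poly_roots_bound[OF this] show ?thesis
    by (simp add: deg poly_monom)
qed

text \<open>
  The \<open>n\<close>-th power map sends the \<open>n k\<close> nonzero elements into the at most \<open>k\<close> solutions of
  \<open>y ^ k = 1\<close>, and each fibre has at most \<open>n\<close> elements. So the fibre over each of these solutions must
  have exactly \<open>n\<close> elements.
\<close>

lemma card_nth_roots:
  fixes c :: "'a::{field,finite}"
  assumes nk: "n * k = CARD('a) - 1" and c: "c ^ k = 1"
  shows "card {z. z ^ n = c} = n"
proof -
  have "CARD('a) > 1"
    using card_mono[of "UNIV :: 'a set" "{0,1}"] by simp
  then have pos: "n > 0" "k > 0"
    using nk by (auto intro!: Nat.gr0I)
  let ?U = "UNIV - {0::'a}"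
  let ?P = "(\<lambda>z. z ^ n) ` ?U"
  let ?C = "{y. y ^ k = (1::'a)}"
  have sub: "?P \<subseteq> ?C"
    using finite_field_power_card_minus_1 by (auto simp flip: power_mult simp: nk)
  have fibre: "card {z \<in> ?U. z ^ n = y} \<le> n" for y :: 'a
    using card_nth_roots_le[OF pos(1), of y] card_mono[of "{z. z ^ n = y}" "{z \<in> ?U. z ^ n = y}"]
    by fastforce
  have cardU: "card ?U = n * k"
    by (simp add: nk card_Diff_singleton)
  have "c \<noteq> 0"
    using c pos by (auto simp: power_0_left)
  have "c \<in> ?C"
    using c by simp
  then have "card (?C - {c}) \<le> k - 1"
    using card_nth_roots_le[OF pos(2), of "1::'a"]
    by (simp add: card_Diff_singleton diff_le_mono del: One_nat_def)
  have "card ?U = (\<Sum>y\<in>?C. card {z \<in> ?U. z ^ n = y})"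
    using sum.group[of ?U ?C "\<lambda>z. z ^ n" "\<lambda>_. 1::nat"] sub by simp
  also have "\<dots> = card {z \<in> ?U. z ^ n = c} + (\<Sum>y\<in>?C - {c}. card {z \<in> ?U. z ^ n = y})"
    using \<open>c \<in> ?C\<close> by (intro sum.remove) auto
  also have "\<dots> \<le> card {z \<in> ?U. z ^ n = c} + card (?C - {c}) * n"
    using sum_bounded_above[of "?C - {c}" "\<lambda>y. card {z \<in> ?U. z ^ n = y}" n] fibre by simp
  also have "\<dots> \<le> card {z \<in> ?U. z ^ n = c} + (k - 1) * n"
    using \<open>card (?C - {c}) \<le> k - 1\<close> by (intro add_left_mono mult_right_mono) auto
  finally have "n * k \<le> card {z \<in> ?U. z ^ n = c} + (k - 1) * n"
    using cardU by simp
  then have "n \<le> card {z \<in> ?U. z ^ n = c}"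
    using pos by (cases k) (auto simp: algebra_simps)
  moreover have "{z \<in> ?U. z ^ n = c} = {z. z ^ n = c}"
    using \<open>c \<noteq> 0\<close> pos by auto
  ultimately show ?thesis
    using card_nth_roots_le[OF pos(1), of c] by simp
qed

section \<open>The Frobenius map\<close>

locale quartic_extension = field_embedding \<iota>
  for \<iota> :: "'k::{field,finite} \<Rightarrow> 'a::{field,finite}" +
  fixes q :: nat
  assumes primepow_q: "primepow q"
    and card_small: "CARD('k) = q"
    and card_large: "CARD('a) = q ^ 4"
begin

text \<open>
  The norms and the defining polynomial of \<open>Ub\<close> are rewritten in terms of \<open>frob\<close>, whose
  homomorphism laws as simplification rules then make conjugating an equation a single step.
  Signs commute with \<open>frob\<close> in every characteristic, which avoids a case distinction on the parity
  of \<open>q\<close>.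
\<close>

definition frob :: "'a \<Rightarrow> 'a" where
  "frob x = x ^ q"

lemma q_gt_1: "q > 1"
  using primepow_gt_Suc_0[OF primepow_q] by simp

lemma frob_mult [simp]: "frob (x * y) = frob x * frob y"
  by (simp add: frob_def power_mult_distrib)

lemma frob_zero [simp]: "frob 0 = 0" and frob_one [simp]: "frob 1 = 1"
  using q_gt_1 by (auto simp: frob_def)

lemma frob_add [simp]: "frob (x + y) = frob x + frob y"
proof -
  obtain p k where pk: "prime p" "k > 0" "q = p ^ k"
    using primepow_q by (auto simp: primepow_def)
  have char: "prime CHAR('a)"
    by (intro prime_CHAR_semidom finite_imp_CHAR_pos) simp
  have "CHAR('a) dvd p ^ (k * 4)"
    using CHAR_dvd_CARD[where 'a = 'a] by (simp add: card_large pk(3) power_mult)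
  then have "CHAR('a) = p"
    using primes_dvd_imp_eq[OF char pk(1)] prime_dvd_power[OF char] by simp
  with pk(3) have "q = CHAR('a) ^ k"
    by simp
  from freshmans_dream'[OF char this] show ?thesis
    unfolding frob_def .
qed

lemma frob_minus [simp]: "frob (- x) = - frob x"
  using frob_add[of x "- x"] by (simp add: eq_neg_iff_add_eq_0 add.commute del: frob_add)

lemma frob_diff [simp]: "frob (x - y) = frob x - frob y"
  using frob_add[of x "- y"] by simp

lemma frob_eq_0_iff [simp]: "frob x = 0 \<longleftrightarrow> x = 0"
  using q_gt_1 by (auto simp: frob_def)

lemma frob_twice: "frob (frob x) = x ^ (q\<^sup>2)"
  and frob_thrice: "frob (frob (frob x)) = x ^ (q ^ 3)"
  by (simp_all add: frob_def eval_nat_numeral mult.assoc flip: power_mult)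

lemma frob_four [simp]: "frob (frob (frob (frob x))) = x"
proof -
  have "frob (frob (frob (frob x))) = x ^ CARD('a)"
    by (simp add: card_large frob_def eval_nat_numeral mult.assoc flip: power_mult)
  then show ?thesis
    by (simp add: finite_field_power_card)
qed

lemma frob_eq_iff [simp]: "frob x = frob y \<longleftrightarrow> x = y"
  by (metis frob_four)

lemma hom_power: "\<iota> (x ^ n) = \<iota> x ^ n"
  by (induction n) (simp_all add: hom_one hom_mult)

lemma frob_embedding [simp]: "frob (\<iota> c) = \<iota> c"
  using finite_field_power_card[of c] by (simp add: frob_def card_small flip: hom_power)

lemma norm_q4_q_eq: "norm_q4_q q b = b * frob b * frob (frob b) * frob (frob (frob b))"
  by (simp only: norm_q4_q_def power_add power_one_right frob_thrice)
    (simp only: frob_twice, simp only: frob_def)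

lemma norm_q4_q2_eq: "norm_q4_q2 q b = b * frob (frob b)"
  by (simp add: norm_q4_q2_def frob_twice)

lemma norm_q4_q_via_q2: "norm_q4_q q b = norm_q4_q2 q b * frob (norm_q4_q2 q b)"
  by (simp add: norm_q4_q_eq norm_q4_q2_eq mult_ac)

lemma card_roots_le:
  assumes "a \<noteq> 0 \<or> c \<noteq> 0"
  shows "card {x. a * x + c * frob x = 0} \<le> q"
proof -
  let ?p = "Polynomial.monom a 1 + Polynomial.monom c q"
  have "Polynomial.coeff ?p 1 = a" "Polynomial.coeff ?p q = c"
    using q_gt_1 by auto
  then have "?p \<noteq> 0"
    using assms by (metis coeff_0)
  moreover have "degree ?p \<le> q"
    using q_gt_1 by (intro degree_add_le order.trans[OF degree_monom_le]) auto
  ultimately show ?thesis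
    using card_poly_roots_bound[of ?p] by (simp add: poly_monom frob_def)
qed

lemma card_roots_le_square:
  assumes "d \<noteq> 0"
  shows "card {x. a * x + c * frob x + d * frob (frob x) = 0} \<le> q\<^sup>2"
proof -
  let ?p = "Polynomial.monom a 1 + Polynomial.monom c q + Polynomial.monom d (q\<^sup>2)"
  have "q < q\<^sup>2"
    using q_gt_1 by (simp add: power2_eq_square)
  then have "Polynomial.coeff ?p (q\<^sup>2) = d"
    using q_gt_1 by auto
  then have "?p \<noteq> 0"
    using assms by (metis coeff_0)
  moreover have "degree ?p \<le> q\<^sup>2"
    using q_gt_1 \<open>q < q\<^sup>2\<close>
    by (intro degree_add_le order.trans[OF degree_monom_le]) auto
  ultimately show ?thesis
    using card_poly_roots_bound[of ?p]
    by (simp add: poly_monom frob_twice) (simp add: frob_def)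
qed

section \<open>The kernels cut out by the points\<close>

text \<open>
  These \<open>x\<close> are the first coordinates of the vectors of \<open>Ub q b\<close> lying on the line of slope \<open>m\<close>.
\<close>

definition slope_kernel :: "'a \<Rightarrow> 'a \<Rightarrow> 'a set" where
  "slope_kernel b m = {x. b * frob x + frob (frob (frob x)) = m * x}"

text \<open>
  These two equations say that both coefficients vanish in the relation between \<open>frob x\<close> and
  \<open>frob (frob x)\<close> which elimination yields for \<open>x\<close> in the slope kernel; equivalently, that the
  4-by-4 matrix of the conjugate relations has rank two.
\<close>

definition heavy :: "'a \<Rightarrow> 'a \<Rightarrow> bool" where
  "heavy b m \<longleftrightarrow> 1 + frob (frob b) * m * frob m = b * frob (frob b) \<and>
     frob (frob m) = - (m * frob b * frob (frob b))"

text \<open>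
  Conjugating the defining equation once lowers its \<open>q\<close>-degree from 3 to 2, because the fourth power
  of the Frobenius map is the identity.
\<close>

lemma slope_kernel_frob:
  assumes "x \<in> slope_kernel b m"
  shows "x = frob m * frob x - frob b * frob (frob x)"
proof -
  have "frob (b * frob x + frob (frob (frob x))) = frob (m * x)"
    using assms by (simp add: slope_kernel_def)
  then show ?thesis
    by (simp add: algebra_simps)
qed

text \<open>
  The Frobenius map embeds the kernel into the solutions of \<open>a y = c y\<^sup>q\<close>, where \<open>a\<close> and \<open>c\<close> are the
  coefficients left by the elimination.
\<close>

lemma card_slope_kernel_le_if_not_heavy:
  assumes "\<not> heavy b m"
  shows "card (slope_kernel b m) \<le> q"
proof -
  define a where "a = 1 + frob (frob b) * m * frob m - b * frob (frob b)"
  define c where "c = frob (frob m) + m * frob b * frob (frob b)"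
  have "a \<noteq> 0 \<or> c \<noteq> 0"
    using assms by (simp add: heavy_def a_def c_def eq_neg_iff_add_eq_0)
  then have "a \<noteq> 0 \<or> - c \<noteq> 0"
    by simp
  moreover have "frob ` slope_kernel b m \<subseteq> {y. a * y + - c * frob y = 0}"
  proof safe
    fix x assume x: "x \<in> slope_kernel b m"
    define x1 x2 x3 where "x1 = frob x" and "x2 = frob x1" and "x3 = frob x2"
    have e0: "b * x1 + x3 = m * x"
      using x by (simp add: slope_kernel_def x1_def x2_def x3_def)
    have e1: "x = frob m * x1 - frob b * x2"
      using slope_kernel_frob[OF x] by (simp add: x1_def x2_def)
    have "frob x = frob (frob m * x1 - frob b * x2)"
      using e1 by simp
    then have e2: "x1 = frob (frob m) * x2 - frob (frob b) * x3"
      by (simp add: x1_def x2_def x3_def)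
    \<comment> \<open>the combination of the three relations in which \<open>x\<close> and \<open>x3\<close> cancel\<close>
    have "a * x1 - c * x2 = (x1 - (frob (frob m) * x2 - frob (frob b) * x3))
        - frob (frob b) * (b * x1 + x3 - m * x)
        - frob (frob b) * m * (x - (frob m * x1 - frob b * x2))"
      by (simp add: a_def c_def algebra_simps)
    also have "\<dots> = 0"
      unfolding right_minus_eq[THEN iffD2, OF e0] right_minus_eq[THEN iffD2, OF e1]
        right_minus_eq[THEN iffD2, OF e2]
      by simp
    finally have "a * x1 - c * x2 = 0" .
    then show "a * frob x + - c * frob (frob x) = 0"
      by (simp add: x1_def x2_def)
  qed
  ultimately have "card (frob ` slope_kernel b m) \<le> q"
    using card_roots_le[of a "- c"]
      card_mono[of "{y. a * y + - c * frob y = 0}" "frob ` slope_kernel b m"]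
    by fastforce
  then show ?thesis
    by (simp add: card_image inj_on_def)
qed

text \<open>
  The upper bound is the degree of the equation from \<open>slope_kernel_frob\<close>. For the lower bound, look
  for an additive map \<open>h\<close> of \<open>q\<close>-degree 2 annihilated by \<open>x \<mapsto> f x - m x\<close>. Comparing coefficients
  in \<open>b (h x)\<^sub>1 + (h x)\<^sub>3 = m (h x)\<close> determines \<open>h\<close> up to rescaling of \<open>x\<close>; the system is solvable
  because \<open>m\<close> is heavy. Since \<open>h\<close> has at most \<open>q\<^sup>2\<close> zeros, its image has at least \<open>q\<^sup>2\<close> elements.
\<close>

lemma card_slope_kernel_if_heavy:
  assumes "heavy b m"
  shows "card (slope_kernel b m) = q\<^sup>2"
proof (rule antisym)
  have A: "1 + frob (frob b) * m * frob m = b * frob (frob b)"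
    and B: "frob (frob m) = - (m * frob b * frob (frob b))"
    using assms by (auto simp: heavy_def)
  have b: "frob b \<noteq> 0"
    using A by auto
  have "slope_kernel b m \<subseteq> {x. 1 * x + (- frob m) * frob x + frob b * frob (frob x) = 0}"
    using slope_kernel_frob[of _ b m] by (auto simp: algebra_simps)
  then show "card (slope_kernel b m) \<le> q\<^sup>2"
    using card_roots_le_square[OF b, of 1 "- frob m"]
    by (meson card_mono finite_class.finite_code order.trans finite)
  \<comment> \<open>the factor 1 puts \<open>h\<close> into the form of \<open>card_roots_le_square\<close>\<close>
  define h where "h x = - frob b * x + - (frob m * frob (frob b)) * frob x + 1 * frob (frob x)" for x
  have h_diff: "h (x - y) = h x - h y" for x y
    by (simp add: h_def algebra_simps)
  have "h x \<in> slope_kernel b m" for x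
  proof -
    define x1 x2 x3 where "x1 = frob x" and "x2 = frob x1" and "x3 = frob x2"
    define b1 b2 b3 where "b1 = frob b" and "b2 = frob b1" and "b3 = frob b2"
    define m1 m2 m3 where "m1 = frob m" and "m2 = frob m1" and "m3 = frob m2"
    note defs = x1_def x2_def x3_def b1_def b2_def b3_def m1_def m2_def m3_def
    have A0: "1 + b2 * m * m1 = b * b2" and B0: "m2 = - (m * b1 * b2)"
      using A B by (simp_all add: defs)
    have "m = frob (frob m2)"
      by (simp add: defs)
    also have "\<dots> = frob (frob (- (m * b1 * b2)))"
      by (simp only: B0)
    also have "\<dots> = - (m2 * b3 * b)"
      by (simp add: defs)
    finally have B2: "m = - (m2 * b3 * b)" .
    have h: "h x = x2 - m1 * b2 * x1 - b1 * x"
      by (simp add: h_def defs)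
    have h1: "frob (h x) = x3 - m2 * b3 * x2 - b2 * x1"
      by (simp add: h defs)
    have h2: "frob (frob (h x)) = x - m3 * b * x3 - b3 * x2"
      by (simp add: h1 defs)
    have h3: "frob (frob (frob (h x))) = x1 - m * b1 * x - b * x3"
      by (simp add: h2 defs)
    have "b * frob (h x) + frob (frob (frob (h x))) = m * h x"
    proof -
      have "b * frob (h x) + frob (frob (frob (h x))) - m * h x =
          x1 * (1 + b2 * m * m1 - b * b2) - b * x2 * (m2 * b3) - x2 * m"
        unfolding h3 unfolding h1 unfolding h by (simp add: algebra_simps)
      also have "\<dots> = x1 * (1 + b2 * m * m1 - b * b2) - x2 * (m - - (m2 * b3 * b))"
        by (simp add: algebra_simps)
      also have "\<dots> = 0"
        unfolding right_minus_eq[THEN iffD2, OF A0] right_minus_eq[THEN iffD2, OF B2] by simp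
      finally show ?thesis
        by simp
    qed
    then show ?thesis
      by (simp add: slope_kernel_def)
  qed
  then have "card (range h) \<le> card (slope_kernel b m)"
    by (intro card_mono) auto
  moreover have "card {x \<in> UNIV. h x = y} \<le> q\<^sup>2" if "y \<in> range h" for y
  proof -
    obtain x0 where x0: "y = h x0"
      using \<open>y \<in> range h\<close> by blast
    have "card {x \<in> UNIV. h x = y} = card ((\<lambda>x. x - x0) ` {x \<in> UNIV. h x = y})"
      by (simp add: card_image inj_on_def)
    also have "\<dots> \<le> card {x. h x = 0}"
      by (intro card_mono) (auto simp: h_diff x0)
    also have "\<dots> \<le> q\<^sup>2"
      unfolding h_def by (rule card_roots_le_square) simp
    finally show ?thesis .
  qed
  then have "CARD('a) \<le> card (range h) * q\<^sup>2"
    by (intro card_le_image_mult_fibre_bound) auto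
  then have "q\<^sup>2 * q\<^sup>2 \<le> card (range h) * q\<^sup>2"
    by (simp add: card_large flip: power_add)
  then have "q\<^sup>2 \<le> card (range h)"
    using q_gt_1 by (subst (asm) mult_le_cancel2) simp
  ultimately show "q\<^sup>2 \<le> card (slope_kernel b m)"
    by simp
qed

section \<open>Weights of points\<close>

sublocale space: vector_space "\<lambda>c. scale_pair (\<iota> c)"
  by (rule vector_space_restrict_scalars)

lemma proj_point_eq:
  fixes v :: "'a \<times> 'a"
  shows "proj_point v = range (\<lambda>c. scale_pair c v)"
proof -
  interpret vector_space "scale_pair :: 'a \<Rightarrow> _"
    by (rule vector_space_scale_pair)
  show ?thesis
    by (simp add: proj_point_def span_singleton)
qed

lemma mem_proj_point_slope:
  fixes m :: 'a
  shows "(x, y) \<in> proj_point (1, m) \<longleftrightarrow> y = m * x"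
  by (auto simp: proj_point_eq scale_pair_def)

lemma proj_point_slope_inj:
  fixes m m' :: 'a
  shows "proj_point (1, m) = proj_point (1, m') \<longleftrightarrow> m = m'"
  by (metis mem_proj_point_slope mult.right_neutral)

lemma proj_point_affine:
  fixes x y :: 'a
  assumes "x \<noteq> 0"
  shows "proj_point (x, y) = proj_point (1, y / x)"
proof safe
  fix u v assume "(u, v) \<in> proj_point (x, y)"
  then show "(u, v) \<in> proj_point (1, y / x)"
    using assms by (auto simp: proj_point_eq mem_proj_point_slope scale_pair_def)
next
  fix u v assume "(u, v) \<in> proj_point (1, y / x)"
  then have "(u, v) = scale_pair (u / x) (x, y)"
    using assms by (simp add: mem_proj_point_slope scale_pair_def)
  then show "(u, v) \<in> proj_point (x, y)"
    by (auto simp: proj_point_eq)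
qed

lemma mem_Ub: "(x, y) \<in> Ub q b \<longleftrightarrow> y = b * frob x + frob (frob (frob x))"
  by (simp only: frob_thrice) (auto simp: Ub_def frob_def)

text \<open>
  The map \<open>x \<mapsto> (x, m x)\<close> identifies the slope kernel with the intersection whose dimension is the
  weight.
\<close>

lemma card_slope_kernel_eq_power_weight:
  "card (slope_kernel b m) = q ^ weight \<iota> (Ub q b) (proj_point (1, m))"
proof -
  let ?W = "Ub q b \<inter> proj_point (1, m)"
  have W: "?W = (\<lambda>x. (x, m * x)) ` slope_kernel b m"
    by (auto simp: mem_Ub mem_proj_point_slope slope_kernel_def)
  have "\<iota> c * x \<in> slope_kernel b m" if "x \<in> slope_kernel b m" for c x
  proof -
    have "\<iota> c * (b * frob x + frob (frob (frob x))) = \<iota> c * (m * x)"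
      using that by (simp add: slope_kernel_def)
    then show ?thesis
      by (simp add: slope_kernel_def algebra_simps)
  qed
  then have "space.subspace ?W"
    unfolding space.subspace_def W
    by (auto simp: slope_kernel_def scale_pair_def zero_prod_def algebra_simps image_iff)
  then have "card ?W = CARD('k) ^ space.dim ?W"
    by (intro space.card_subspace_eq_power_dim) auto
  moreover have "card ?W = card (slope_kernel b m)"
    unfolding W by (rule card_image) (simp add: inj_on_def)
  ultimately show ?thesis
    by (simp add: weight_def card_small)
qed

lemma zero_in_slope_kernel: "0 \<in> slope_kernel b m"
  by (simp add: slope_kernel_def)

lemma linear_setI:
  assumes "x \<in> slope_kernel b m" and "x \<noteq> 0"
  shows "proj_point (1, m) \<in> linear_set (Ub q b)"
proof -
  have "(x, m * x) \<in> Ub q b"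
    using assms(1) unfolding mem_Ub slope_kernel_def by simp
  moreover have "(x, m * x) \<noteq> 0"
    using assms(2) by (simp add: zero_prod_def)
  moreover have "proj_point (1, m) = proj_point (x, m * x)"
    using proj_point_affine[OF assms(2), of "m * x"] assms(2) by simp
  ultimately show ?thesis
    unfolding linear_set_def by blast
qed

text \<open>
  A nonzero vector of \<open>Ub q b\<close> has a nonzero first coordinate, since the second one vanishes with it.
  So all points of the linear set have a slope.
\<close>

lemma linear_setE:
  assumes "P \<in> linear_set (Ub q b)"
  obtains m x where "P = proj_point (1, m)" "x \<in> slope_kernel b m" "x \<noteq> 0"
proof -
  obtain v where v: "v \<in> Ub q b" "v \<noteq> 0" "P = proj_point v"
    using assms unfolding linear_set_def by blast
  obtain x y where xy: "v = (x, y)"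
    by (cases v)
  have y: "y = b * frob x + frob (frob (frob x))"
    using v(1) unfolding xy mem_Ub .
  have "x \<noteq> 0"
  proof
    assume "x = 0"
    then show False
      using v(2) y by (simp add: xy zero_prod_def)
  qed
  moreover have "x \<in> slope_kernel b (y / x)"
    using y \<open>x \<noteq> 0\<close> by (simp add: slope_kernel_def)
  ultimately show ?thesis
    using that v(3) proj_point_affine[of x y] unfolding xy by metis
qed

lemma weight_if_heavy:
  assumes "heavy b m"
  shows "weight \<iota> (Ub q b) (proj_point (1, m)) = 2"
proof -
  have "q ^ weight \<iota> (Ub q b) (proj_point (1, m)) = q ^ 2"
    using card_slope_kernel_if_heavy[OF assms] card_slope_kernel_eq_power_weight by metis
  then show ?thesis
    using q_gt_1 power_inject_exp by blast
qed

lemma weight_if_not_heavy: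
  assumes "\<not> heavy b m" and "proj_point (1, m) \<in> linear_set (Ub q b)"
  shows "weight \<iota> (Ub q b) (proj_point (1, m)) = 1"
proof -
  let ?w = "weight \<iota> (Ub q b) (proj_point (1, m))"
  have "q ^ ?w \<le> q ^ 1"
    using card_slope_kernel_le_if_not_heavy[OF assms(1)]
    unfolding card_slope_kernel_eq_power_weight power_one_right .
  then have "?w \<le> 1"
    using q_gt_1 power_le_imp_le_exp by blast
  moreover have "?w \<noteq> 0"
  proof
    assume "?w = 0"
    then have "card (slope_kernel b m) = 1"
      unfolding card_slope_kernel_eq_power_weight by simp
    then have "slope_kernel b m = {0}"
      using zero_in_slope_kernel by (metis card_1_singletonE singletonD)
    moreover obtain m' x where "proj_point (1, m) = proj_point (1, m')" "x \<in> slope_kernel b m'" "x \<noteq> 0"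
      using assms(2) by (rule linear_setE)
    ultimately show False
      by (simp add: proj_point_slope_inj)
  qed
  ultimately show ?thesis
    by simp
qed

lemma heavy_in_linear_set:
  assumes "heavy b m"
  shows "proj_point (1, m) \<in> linear_set (Ub q b)"
proof -
  have "card (slope_kernel b m) > 1"
    using card_slope_kernel_if_heavy[OF assms] q_gt_1 by (simp add: one_less_power del: One_nat_def)
  then have "\<not> slope_kernel b m \<subseteq> {0}"
    using card_mono[of "{0}" "slope_kernel b m"] by auto
  then show ?thesis
    using linear_setI by blast
qed

lemma weight_two_points:
  "{P \<in> linear_set (Ub q b). weight \<iota> (Ub q b) P = 2} = (\<lambda>m. proj_point (1, m)) ` {m. heavy b m}"
proof safe
  fix P assume P: "P \<in> linear_set (Ub q b)" and w: "weight \<iota> (Ub q b) P = 2"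
  obtain m where m: "P = proj_point (1, m)"
    using P by (rule linear_setE)
  then have "heavy b m"
    using weight_if_not_heavy[of b m] P w by auto
  then show "P \<in> (\<lambda>m. proj_point (1, m)) ` {m. heavy b m}"
    using m by blast
qed (simp_all add: weight_if_heavy heavy_in_linear_set)

lemma weight_one_or_two:
  assumes "P \<in> linear_set (Ub q b)"
  shows "weight \<iota> (Ub q b) P = 1 \<or> weight \<iota> (Ub q b) P = 2"
proof -
  obtain m where "P = proj_point (1, m)"
    using assms by (rule linear_setE)
  then show ?thesis
    using assms weight_if_heavy[of b m] weight_if_not_heavy[of b m] by blast
qed

section \<open>Solving for the heavy slopes\<close>

text \<open>
  For \<open>m \<noteq> 0\<close>, applying the second heaviness equation to itself multiplies \<open>m\<close> by the norm of \<open>b\<close>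
  while returning to \<open>m\<close>.
\<close>

lemma heavy_imp_norm_1:
  assumes "heavy b m"
  shows "norm_q4_q q b = 1"
proof (cases "m = 0")
  case True
  then have "norm_q4_q2 q b = 1"
    using assms by (simp add: heavy_def norm_q4_q2_eq)
  then show ?thesis
    by (simp add: norm_q4_q_via_q2)
next
  case False
  have B: "frob (frob m) = - (m * frob b * frob (frob b))"
    using assms by (simp add: heavy_def)
  have "m = frob (frob (frob (frob m)))"
    by simp
  also have "\<dots> = m * norm_q4_q q b"
    unfolding B by (simp add: B norm_q4_q_eq mult_ac)
  finally show ?thesis
    using False by simp
qed

lemma heavy_iff_zero:
  assumes "norm_q4_q2 q b = 1"
  shows "heavy b m \<longleftrightarrow> m = 0"
  using assms by (auto simp: heavy_def norm_q4_q2_eq)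

text \<open>
  Since \<open>1 / b\<^sub>2 = b b\<^sub>1 b\<^sub>3\<close>, the first heaviness equation is \<open>m^(q+1) = c\<close> with \<open>c = b (1 - b\<^sub>1 b\<^sub>3)\<close>.
  The norm condition gives \<open>c\<^sup>q = - b\<^sub>1 b\<^sub>2 c\<close>; dividing the conjugate of \<open>m m\<^sub>1 = c\<close> by \<open>m\<^sub>1\<close> then yields the
  second heaviness equation, and the same identity shows that \<open>c\<close> is a \<open>(q+1)\<close>-st power.
\<close>

lemma card_heavy:
  assumes N: "norm_q4_q q b = 1" and N2: "norm_q4_q2 q b \<noteq> 1"
  shows "card {m. heavy b m} = q + 1"
proof -
  define b1 b2 b3 where "b1 = frob b" and "b2 = frob b1" and "b3 = frob b2"
  note defs = b1_def b2_def b3_def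
  have N': "b * b1 * b2 * b3 = 1" and N2': "b * b2 \<noteq> 1"
    using N N2 by (simp_all add: norm_q4_q_eq norm_q4_q2_eq defs)
  define c where "c = b * (1 - b1 * b3)"
  have "b * b2 * (1 - b1 * b3) \<noteq> 0"
    using N' N2' by (simp add: algebra_simps)
  then have c0: "c \<noteq> 0"
    by (auto simp: c_def)
  have "frob c = b1 * (1 - b2 * b)"
    by (simp add: c_def defs)
  also have "\<dots> = b1 * (b * b1 * b2 * b3 - b2 * b)"
    by (simp only: N')
  also have "\<dots> = - (b1 * b2) * c"
    by (simp add: c_def algebra_simps)
  finally have frob_c: "frob c = - (b1 * b2) * c" .
  have b0: "b \<noteq> 0" "b1 \<noteq> 0" "b2 \<noteq> 0" "b3 \<noteq> 0"
    using N' by auto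
  have heavy_iff: "heavy b m \<longleftrightarrow> m ^ (q + 1) = c" for m
  proof -
    have "b2 * c = b * b2 - b * b1 * b2 * b3"
      by (simp add: c_def algebra_simps)
    then have "b * b2 = 1 + b2 * c"
      by (simp add: N')
    then have "1 + b2 * m * frob m = b * b2 \<longleftrightarrow> b2 * (m * frob m) = b2 * c"
      by (simp only: mult.assoc add_left_cancel)
    then have A: "1 + b2 * m * frob m = b * b2 \<longleftrightarrow> m * frob m = c"
      using b0 by simp
    have B: "frob (frob m) = - (m * b1 * b2)" if "m * frob m = c"
    proof -
      have "frob m * frob (frob m) = - (b1 * b2) * (m * frob m)"
        using frob_c that by auto
      then have "frob m * frob (frob m) = frob m * - (m * b1 * b2)"
        by (simp add: mult_ac)
      moreover have "frob m \<noteq> 0"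
        using that c0 by auto
      ultimately show ?thesis
        using mult_left_cancel by blast
    qed
    have "m ^ (q + 1) = m * frob m"
      by (simp add: frob_def)
    then show ?thesis
      using A B by (auto simp: heavy_def defs)
  qed
  have "c * c ^ (q - 1) = frob c"
    using q_gt_1 by (simp add: frob_def flip: power_Suc)
  then have "c ^ (q - 1) = - (b1 * b2)"
    using frob_c c0 by (metis mult.commute mult_left_cancel)
  then have "c ^ ((q - 1) * (q\<^sup>2 + 1)) = (- (b1 * b2)) ^ (q\<^sup>2 + 1)"
    by (simp only: power_mult)
  also have "\<dots> = - (b1 * b2) * frob (frob (- (b1 * b2)))"
    by (simp only: frob_twice power_add power_one_right mult.commute)
  also have "\<dots> = 1"
    using N' by (simp add: defs mult_ac)
  finally have "c ^ ((q - 1) * (q\<^sup>2 + 1)) = 1" .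
  moreover have "(q + 1) * ((q - 1) * (q\<^sup>2 + 1)) = CARD('a) - 1"
  proof -
    obtain r where "q = Suc r"
      using q_gt_1 by (cases q) auto
    then show ?thesis
      by (simp add: card_large eval_nat_numeral algebra_simps)
  qed
  ultimately show ?thesis
    using card_nth_roots[of "q + 1"] by (simp add: heavy_iff)
qed

end

section \<open>The classification\<close>

theorem theorem2p1:
  fixes q :: nat
    and \<iota> :: "'k::{field,finite} \<Rightarrow> 'a::{field,finite}"
    and b :: 'a
  assumes "primepow q"
    and "CARD('k) = q"
    and "CARD('a) = q ^ 4"
    and "field_embedding \<iota>"
  shows "(norm_q4_q q b \<noteq> 1 \<longrightarrow> scattered \<iota> (Ub q b)) \<and>
    (norm_q4_q2 q b = 1 \<longrightarrow>
      {P \<in> linear_set (Ub q b). weight \<iota> (Ub q b) P = 2} = {proj_point (1, 0)} \<and>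
      (\<forall>P \<in> linear_set (Ub q b). P \<noteq> proj_point (1, 0) \<longrightarrow> weight \<iota> (Ub q b) P = 1)) \<and>
    (norm_q4_q2 q b \<noteq> 1 \<and> norm_q4_q q b = 1 \<longrightarrow>
      card {P \<in> linear_set (Ub q b). weight \<iota> (Ub q b) P = 2} = q + 1 \<and>
      (\<forall>P \<in> linear_set (Ub q b).
         weight \<iota> (Ub q b) P \<noteq> 2 \<longrightarrow> weight \<iota> (Ub q b) P = 1))"
proof -
  interpret quartic_extension \<iota> q
    by (intro quartic_extension.intro quartic_extension_axioms.intro assms)
  note two = weight_two_points[of b]
  show ?thesis
  proof (intro conjI impI)
    assume "norm_q4_q q b \<noteq> 1"
    then have "{m. heavy b m} = {}"
      using heavy_imp_norm_1 by blast
    then show "scattered \<iota> (Ub q b)"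
      using two weight_one_or_two[of _ b] by (auto simp: scattered_def)
  next
    assume "norm_q4_q2 q b = 1"
    then show *: "{P \<in> linear_set (Ub q b). weight \<iota> (Ub q b) P = 2} = {proj_point (1, 0)}"
      using two by (simp add: heavy_iff_zero)
    show "\<forall>P \<in> linear_set (Ub q b). P \<noteq> proj_point (1, 0) \<longrightarrow> weight \<iota> (Ub q b) P = 1"
      using * weight_one_or_two[of _ b] by blast
  next
    assume "norm_q4_q2 q b \<noteq> 1 \<and> norm_q4_q q b = 1"
    then show "card {P \<in> linear_set (Ub q b). weight \<iota> (Ub q b) P = 2} = q + 1"
      using two by (simp add: card_heavy card_image inj_on_def proj_point_slope_inj)
    show "\<forall>P \<in> linear_set (Ub q b). weight \<iota> (Ub q b) P \<noteq> 2 \<longrightarrow> weight \<iota> (Ub q b) P = 1"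
      using weight_one_or_two[of _ b] by blast
  qed
qed

end
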